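(* Consider the transversal achievement game on the $n\times n$ board. The first player wins (i.e. has a winning strategy) for $n=1$ and for every $n\ge 4$; for $n=2$ and $n=3$ the game is a draw (i.e. neither player has a winning strategy).
   Context: Transversal achievement game on the $n\times n$ board ($n\ge1$): two players alternately claim previously unclaimed cells of an $n\times n$ grid; Player 1 (called X) moves first, Player 2 is called O. A transversal is a set of $n$ cells of which no two share a row or a column. The first player to own a set of cells containing a transversal wins. If neither player ever does so (the board fills up), the game is a draw. *)

theory Defs
  imports Main
begin

type_synonym cell = "nat \<times> nat"

datatype player = PlayerX | PlayerO

definition board :: "nat \<Rightarrow> cell set" where
  "board n = {..<n} \<times> {..<n}"

definition transversal :: "nat \<Rightarrow> cell set \<Rightarrow> bool" where
  "transversal n T \<longleftrightarrow>
     T \<subseteq> board n \<and> card T = n \<and>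
     (\<forall>c\<in>T. \<forall>d\<in>T. c \<noteq> d \<longrightarrow> fst c \<noteq> fst d \<and> snd c \<noteq> snd d)"

text \<open>
  A position is the list of all cells claimed so far, oldest first; the two players alternate
  and X claims the cell with index 0.
\<close>

definition mover :: "nat \<Rightarrow> player" where
  "mover i = (if even i then PlayerX else PlayerO)"

definition owned :: "player \<Rightarrow> cell list \<Rightarrow> cell set" where
  "owned p h = {h ! i | i. i < length h \<and> mover i = p}"

definition has_transversal :: "nat \<Rightarrow> player \<Rightarrow> cell list \<Rightarrow> bool" where
  "has_transversal n p h \<longleftrightarrow> (\<exists>T. transversal n T \<and> T \<subseteq> owned p h)"

definition game_over :: "nat \<Rightarrow> cell list \<Rightarrow> bool" where
  "game_over n h \<longleftrightarrow> (\<exists>p. has_transversal n p h) \<or> set h = board n"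

text \<open>
  Play stops as soon as the game is over. Hence in a legal position at most one player owns a
  transversal, and that player is the first one to do so.
\<close>

definition legal_position :: "nat \<Rightarrow> cell list \<Rightarrow> bool" where
  "legal_position n h \<longleftrightarrow>
     set h \<subseteq> board n \<and> distinct h \<and> (\<forall>i<length h. \<not> game_over n (take i h))"

definition complete_play :: "nat \<Rightarrow> cell list \<Rightarrow> bool" where
  "complete_play n h \<longleftrightarrow> legal_position n h \<and> game_over n h"

type_synonym strategy = "cell list \<Rightarrow> cell"

definition strategy_for :: "nat \<Rightarrow> player \<Rightarrow> strategy \<Rightarrow> bool" where
  "strategy_for n p \<sigma> \<longleftrightarrow>
     (\<forall>h. legal_position n h \<and> \<not> game_over n h \<and> mover (length h) = p
        \<longrightarrow> \<sigma> h \<in> board n - set h)"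

definition follows :: "player \<Rightarrow> strategy \<Rightarrow> cell list \<Rightarrow> bool" where
  "follows p \<sigma> h \<longleftrightarrow> (\<forall>i<length h. mover i = p \<longrightarrow> h ! i = \<sigma> (take i h))"

definition winning_strategy :: "nat \<Rightarrow> player \<Rightarrow> strategy \<Rightarrow> bool" where
  "winning_strategy n p \<sigma> \<longleftrightarrow>
     strategy_for n p \<sigma> \<and>
     (\<forall>h. complete_play n h \<and> follows p \<sigma> h \<longrightarrow> has_transversal n p h)"

definition has_winning_strategy :: "nat \<Rightarrow> player \<Rightarrow> bool" where
  "has_winning_strategy n p \<longleftrightarrow> (\<exists>\<sigma>. winning_strategy n p \<sigma>)"

definition game_is_draw :: "nat \<Rightarrow> bool" where
  "game_is_draw n \<longleftrightarrow> (\<forall>p. \<not> has_winning_strategy n p)"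

end

theory Submission
  imports Defs
begin

text \<open>
  For \<open>n \<ge> 4\<close>, X first builds a partial transversal, one new cell per move: whenever O plays in the
  subboard of unused rows and columns, X answers in the same row or column, so that this subboard
  contains no O cell and at most one O cell lies on its lines. After \<open>n - 1\<close> moves only one cell
  \<open>(r, c)\<close> is missing and O has to take it. X then plays \<open>(r, j1)\<close> for some own cell \<open>(i1, j1)\<close>,
  threatening \<open>(i1, c)\<close>; O blocks; and X plays \<open>(i2, c)\<close> for another own cell \<open>(i2, j2)\<close>, with the two
  threats \<open>(r, j2)\<close> and \<open>(i1, j2)\<close>. By then O owns at most \<open>n + 1\<close> cells, and the rows and columns
  have been chosen such that two of them are wasted or that O lacks a row and a column.

  For \<open>n = 2\<close> and \<open>n = 3\<close> each player can, after a few opening moves, split the free cells into pairs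
  such that every transversal still open to the opponent contains a pair, and then answers
  each move into a pair by the other cell of that pair.
\<close>

section \<open>The game on sets of cells\<close>

definition contains :: "nat \<Rightarrow> cell set \<Rightarrow> bool" where
  "contains n A \<longleftrightarrow> (\<exists>T. transversal n T \<and> T \<subseteq> A)"

definition ended :: "nat \<Rightarrow> cell set \<Rightarrow> cell set \<Rightarrow> bool" where
  "ended n A B \<longleftrightarrow> contains n A \<or> contains n B \<or> A \<union> B = board n"

text \<open>
  \<open>forces n Q t A B\<close>: the player owning \<open>A\<close> can enforce a final position satisfying \<open>Q\<close>, where the
  opponent owns \<open>B\<close> and \<open>t\<close> says that the owner of \<open>A\<close> is to move.
\<close>

inductive forces :: "nat \<Rightarrow> (cell set \<Rightarrow> cell set \<Rightarrow> bool) \<Rightarrow> bool \<Rightarrow> cell set \<Rightarrow> cell set \<Rightarrow> bool"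
  for n Q where
  over: "ended n A B \<Longrightarrow> Q A B \<Longrightarrow> forces n Q t A B"
| own: "\<not> ended n A B \<Longrightarrow> x \<in> board n - (A \<union> B) \<Longrightarrow> forces n Q False (insert x A) B
    \<Longrightarrow> forces n Q True A B"
| opp: "\<not> ended n A B \<Longrightarrow> (\<And>x. x \<in> board n - (A \<union> B) \<Longrightarrow> forces n Q True A (insert x B))
    \<Longrightarrow> forces n Q False A B"

section \<open>From move sequences to forcing on sets of cells\<close>

fun other :: "player \<Rightarrow> player" where
  "other PlayerX = PlayerO"
| "other PlayerO = PlayerX"

lemma other_other [simp]: "other (other p) = p"
  by (cases p) auto

lemma neq_other: "q \<noteq> p \<longleftrightarrow> q = other p"
  by (cases p; cases q) auto

lemma owned_Nil [simp]: "owned p [] = {}"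
  by (auto simp: owned_def)

lemma owned_snoc:
  "owned p (h @ [x]) = (if mover (length h) = p then insert x (owned p h) else owned p h)"
proof -
  have "owned p (h @ [x]) = (!) (h @ [x]) ` {i. i < Suc (length h) \<and> mover i = p}"
    by (auto simp: owned_def)
  also have "{i. i < Suc (length h) \<and> mover i = p} =
      (if mover (length h) = p then {length h} else {}) \<union> {i. i < length h \<and> mover i = p}"
    by (auto simp: less_Suc_eq)
  also have "(!) (h @ [x]) ` \<dots> = (if mover (length h) = p then {x} else {}) \<union> owned p h"
    by (auto simp: owned_def nth_append image_iff)
  finally show ?thesis by simp
qed

lemma set_owned: "set h = owned p h \<union> owned (other p) h"
  unfolding owned_def neq_other[of _ p, symmetric] set_conv_nth by blast

lemma ended_owned: "ended n (owned p h) (owned (other p) h) \<longleftrightarrow> game_over n h"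
proof -
  have "(\<exists>q. has_transversal n q h) \<longleftrightarrow> has_transversal n p h \<or> has_transversal n (other p) h"
    by (metis neq_other)
  then show ?thesis
    unfolding ended_def game_over_def set_owned[of h p] contains_def has_transversal_def by blast
qed

lemma mover_Suc: "mover (Suc i) = other (mover i)"
  by (simp add: mover_def)

lemma legal_snoc:
  "legal_position n (h @ [x]) \<longleftrightarrow>
     legal_position n h \<and> \<not> game_over n h \<and> x \<in> board n - set h"
  by (auto simp: legal_position_def less_Suc_eq)

lemma follows_snoc:
  "follows p \<sigma> (h @ [x]) \<longleftrightarrow> follows p \<sigma> h \<and> (mover (length h) = p \<longrightarrow> x = \<sigma> h)"
  by (auto simp: follows_def nth_append less_Suc_eq)

lemma finite_board [simp]: "finite (board n)"
  by (simp add: board_def)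

text \<open>The strategy plays any move after which the goal is still forced. Along every play that
  follows it, \<open>forces\<close> is then an invariant, by induction on the last move.\<close>

lemma forces_strategy:
  assumes "forces n Q (p = PlayerX) {} {}"
  obtains \<sigma> where "strategy_for n p \<sigma>"
    and "\<And>h. complete_play n h \<Longrightarrow> follows p \<sigma> h \<Longrightarrow> Q (owned p h) (owned (other p) h)"
proof -
  define good where "good h x \<longleftrightarrow> x \<in> board n - set h \<and>
    forces n Q False (insert x (owned p h)) (owned (other p) h)" for h x
  \<comment> \<open>The second \<open>SOME\<close> is a default for positions without a good move:
    any free cell there satisfies \<open>strategy_for\<close>.\<close>
  define \<sigma> where "\<sigma> h = (if \<exists>x. good h x then SOME x. good h x else SOME x. x \<in> board n - set h)" for h
  have good: "good h (\<sigma> h)" if "good h x" for h x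
    using someI[of "good h", OF that] that unfolding \<sigma>_def by presburger
  have strat: "strategy_for n p \<sigma>"
    unfolding strategy_for_def
  proof (intro allI impI)
    fix h
    assume h: "legal_position n h \<and> \<not> game_over n h \<and> mover (length h) = p"
    then have ex: "\<exists>x. x \<in> board n - set h"
      by (auto simp: legal_position_def game_over_def)
    show "\<sigma> h \<in> board n - set h"
    proof (cases "\<exists>x. good h x")
      case True
      then show ?thesis using good unfolding good_def by blast
    next
      case False
      then show ?thesis using someI_ex[OF ex] by (simp add: \<sigma>_def)
    qed
  qed
  have inv: "forces n Q (mover (length h) = p) (owned p h) (owned (other p) h)"
    if "legal_position n h" "follows p \<sigma> h" for h
    using that
  proof (induction h rule: rev_induct)
    case Nil
    then show ?case using assms by (simp add: mover_def eq_commute)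
  next
    case (snoc x h)
    then have legal: "legal_position n h" "\<not> game_over n h" "x \<in> board n - set h"
      and "follows p \<sigma> h" and x: "mover (length h) = p \<longrightarrow> x = \<sigma> h"
      by (auto simp: legal_snoc follows_snoc)
    with snoc.IH have IH: "forces n Q (mover (length h) = p) (owned p h) (owned (other p) h)" by simp
    have nend: "\<not> ended n (owned p h) (owned (other p) h)"
      using legal by (simp add: ended_owned)
    show ?case
    proof (cases "mover (length h) = p")
      case True
      with IH have "forces n Q True (owned p h) (owned (other p) h)" by simp
      then have "\<exists>y. good h y"
        using nend by cases (auto simp only: good_def set_owned[of h p])
      then obtain y where "good h y" ..
      then have "good h x" using good x True by blast
      then show ?thesis using True by (simp add: owned_snoc mover_Suc good_def) (cases p; simp)
    next
      case False
      with IH have "forces n Q False (owned p h) (owned (other p) h)" by simp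
      then have "forces n Q True (owned p h) (insert x (owned (other p) h))"
        using nend legal by cases (simp_all add: set_owned[of h p])
      then show ?thesis using False by (cases p; cases "mover (length h)") (simp_all add: owned_snoc mover_Suc)
    qed
  qed
  have "Q (owned p h) (owned (other p) h)" if "complete_play n h" "follows p \<sigma> h" for h
  proof -
    have "ended n (owned p h) (owned (other p) h)"
      using that by (simp add: complete_play_def ended_owned)
    moreover have "forces n Q (mover (length h) = p) (owned p h) (owned (other p) h)"
      using that inv by (simp add: complete_play_def)
    \<comment> \<open>In an ended position only the rule \<open>over\<close> applies, and it carries
      \<open>Q\<close>.\<close>
    ultimately show ?thesis by (auto elim: forces.cases)
  qed
  with strat that show ?thesis by blast
qed

text \<open>A single play is read off the derivation: the moves of \<open>q\<close> come from the
  rule \<open>own\<close>, those of \<open>other q\<close> from \<open>\<sigma>\<close>. It reaches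
  an \<open>over\<close> leaf since derivations are well-founded.\<close>

lemma forces_play:
  assumes "forces n Q t A B" "strategy_for n (other q) \<sigma>"
    and "t = (mover (length h) = q)" "A = owned q h" "B = owned (other q) h"
    and "legal_position n h" "follows (other q) \<sigma> h"
  shows "\<exists>h'. complete_play n h' \<and> follows (other q) \<sigma> h' \<and> Q (owned q h') (owned (other q) h')"
  using assms
proof (induction arbitrary: h)
  case (over A B t)
  then show ?case by (auto simp: complete_play_def ended_owned)
next
  case (own A B x)
  then have "legal_position n (h @ [x])"
    by (simp add: legal_snoc ended_owned set_owned[of h q])
  then show ?case
    using own.prems by (intro own.IH[of "h @ [x]"]) (cases q; auto simp: owned_snoc follows_snoc mover_Suc)+
next
  case (opp A B)
  \<comment> \<open>Of all branches of \<open>opp\<close>, the play enters the one chosen by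
    \<open>\<sigma>\<close>.\<close>
  let ?x = "\<sigma> h"
  have m: "mover (length h) = other q" using opp.prems by (simp add: neq_other)
  have free: "?x \<in> board n - set h"
    using opp m by (auto simp: strategy_for_def ended_owned)
  then have "legal_position n (h @ [?x])"
    using opp by (simp add: legal_snoc ended_owned)
  then show ?case
    using opp.prems m free
    by (intro opp.IH[of ?x "h @ [?x]"])
      (cases q; auto simp: owned_snoc follows_snoc mover_Suc set_owned[of h q])+
qed

lemma forces_win:
  assumes "forces n (\<lambda>A B. contains n A) (p = PlayerX) {} {}"
  shows "has_winning_strategy n p"
proof -
  obtain \<sigma> where "strategy_for n p \<sigma>"
    "\<And>h. complete_play n h \<Longrightarrow> follows p \<sigma> h \<Longrightarrow> contains n (owned p h)"
    using forces_strategy[OF assms] by blast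
  then show ?thesis
    by (auto simp: has_winning_strategy_def winning_strategy_def contains_def has_transversal_def)
qed

text \<open>A winning strategy of \<open>other q\<close>, played against the forced line, would end
  in a position where \<open>other q\<close> owns no transversal.\<close>

lemma forces_not_lose:
  assumes "forces n (\<lambda>A B. \<not> contains n B) (q = PlayerX) {} {}"
  shows "\<not> has_winning_strategy n (other q)"
proof
  assume "has_winning_strategy n (other q)"
  then obtain \<sigma> where \<sigma>: "strategy_for n (other q) \<sigma>"
    "\<And>h. complete_play n h \<Longrightarrow> follows (other q) \<sigma> h \<Longrightarrow> contains n (owned (other q) h)"
    by (auto simp: has_winning_strategy_def winning_strategy_def contains_def has_transversal_def)
  have "\<exists>h'. complete_play n h' \<and> follows (other q) \<sigma> h' \<and> \<not> contains n (owned (other q) h')"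
    by (rule forces_play[OF assms \<sigma>(1), of "[]"])
      (auto simp: mover_def legal_position_def follows_def)
  with \<sigma>(2) show False by blast
qed

section \<open>Rules for forcing a transversal, and basic facts on transversals\<close>

lemma forces_own:
  assumes "\<not> contains n B" "x \<in> board n - (A \<union> B)" "forces n (\<lambda>A B. contains n A) False (insert x A) B"
  shows "forces n (\<lambda>A B. contains n A) True A B"
proof (cases "contains n A")
  case True
  then show ?thesis by (auto intro!: over simp: ended_def)
next
  case False
  then show ?thesis using assms by (intro own[of _ A B x]) (auto simp: ended_def)
qed

text \<open>If \<open>A\<close> already holds a transversal, \<open>over\<close> applies. Otherwise
  the free cell \<open>x\<close> witnesses that the board is not full, so the game goes on.\<close>

lemma forces_opp:
  assumes "\<not> contains n B" "x \<in> board n - (A \<union> B)"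
    "\<And>x. x \<in> board n - (A \<union> B) \<Longrightarrow> forces n (\<lambda>A B. contains n A) True A (insert x B)"
  shows "forces n (\<lambda>A B. contains n A) False A B"
proof (cases "contains n A")
  case True
  then show ?thesis by (auto intro!: over simp: ended_def)
next
  case False
  then show ?thesis using assms by (intro opp) (auto simp: ended_def)
qed

lemma forces_now:
  assumes "\<not> contains n B" "x \<in> board n - (A \<union> B)" "contains n (insert x A)"
  shows "forces n (\<lambda>A B. contains n A) True A B"
  using assms by (intro forces_own[of n B x A] over) (auto simp: ended_def)

lemma contains_mono: "contains n A \<Longrightarrow> A \<subseteq> B \<Longrightarrow> contains n B"
  by (auto simp: contains_def)

lemma transversal_iff:
  "transversal n T \<longleftrightarrow> T \<subseteq> board n \<and> card T = n \<and> inj_on fst T \<and> inj_on snd T"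
  unfolding transversal_def inj_on_def by blast

text \<open>The \<open>n\<close> cells lie in different rows, and there are only \<open>n\<close>
  rows.\<close>

lemma transversal_rows:
  assumes "transversal n T"
  shows "fst ` T = {..<n}"
proof (rule card_subset_eq)
  show "fst ` T \<subseteq> {..<n}" using assms by (auto simp: transversal_iff board_def)
  show "card (fst ` T) = card {..<n}" using assms by (simp add: transversal_iff card_image)
qed simp

lemma transversal_cols:
  assumes "transversal n T"
  shows "snd ` T = {..<n}"
proof (rule card_subset_eq)
  show "snd ` T \<subseteq> {..<n}" using assms by (auto simp: transversal_iff board_def)
  show "card (snd ` T) = card {..<n}" using assms by (simp add: transversal_iff card_image)
qed simp

section \<open>Pairing strategies and small boards\<close>

text \<open>The pairs are the two-element orbits, among the free cells, of an involution \<open>f\<close>.\<close>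

definition pairing :: "nat \<Rightarrow> (cell \<Rightarrow> cell) \<Rightarrow> cell set \<Rightarrow> cell set \<Rightarrow> bool" where
  "pairing n f A B \<longleftrightarrow> A \<inter> B = {} \<and> A \<union> B \<subseteq> board n \<and>
     (\<forall>T. transversal n T \<longrightarrow> T \<inter> A \<noteq> {} \<or>
       (\<exists>x\<in>T. f x \<in> T \<and> f x \<noteq> x \<and> x \<notin> A \<union> B \<and> f x \<notin> A \<union> B))"

text \<open>A transversal that avoids \<open>A\<close> contains two free cells, and \<open>x\<close>
  fills at most one of them.\<close>

lemma pairing_not_contains: "pairing n f A B \<Longrightarrow> x \<notin> A \<Longrightarrow> \<not> contains n (insert x B)"
  unfolding pairing_def contains_def by blast

text \<open>A spare cell never hurts: if it breaks the pair of some transversal, that transversal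
  now meets the enlarged \<open>A\<close>.\<close>

lemma pairing_extra:
  assumes "pairing n f A B" "x \<in> board n - (A \<union> B)"
  shows "pairing n f (insert x A) B"
  unfolding pairing_def
proof (intro conjI allI impI)
  show "insert x A \<inter> B = {}" "insert x A \<union> B \<subseteq> board n"
    using assms by (auto simp: pairing_def)
  fix T
  assume "transversal n T"
  then consider "T \<inter> A \<noteq> {}"
    | z where "z \<in> T" "f z \<in> T" "f z \<noteq> z" "z \<notin> A \<union> B" "f z \<notin> A \<union> B"
    using assms(1) unfolding pairing_def by blast
  then show "T \<inter> insert x A \<noteq> {} \<or> (\<exists>z\<in>T. f z \<in> T \<and> f z \<noteq> z \<and>
      z \<notin> insert x A \<union> B \<and> f z \<notin> insert x A \<union> B)"
  proof cases
    case 2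
    then show ?thesis by (cases "x = z"; cases "x = f z") auto
  qed auto
qed

text \<open>If the pair inside a transversal contains \<open>x\<close>, the partner of
  \<open>x\<close> is free, so it equals \<open>y\<close> and the transversal is blocked. A pair
  without \<open>x\<close> either stays free or is met by \<open>y\<close>.\<close>

lemma pairing_reply:
  assumes "pairing n f A B" "\<And>y. f (f y) = y" "x \<in> board n - (A \<union> B)"
    "y \<in> board n - insert x (A \<union> B)"
    "f x \<in> board n - insert x (A \<union> B) \<Longrightarrow> y = f x"
  shows "pairing n f (insert y A) (insert x B)"
  unfolding pairing_def
proof (intro conjI allI impI)
  show "insert y A \<inter> insert x B = {}" "insert y A \<union> insert x B \<subseteq> board n"
    using assms(1,3,4) by (auto simp: pairing_def)
  fix T
  assume T: "transversal n T"
  then consider "T \<inter> A \<noteq> {}"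
    | z where "z \<in> T" "f z \<in> T" "f z \<noteq> z" "z \<notin> A \<union> B" "f z \<notin> A \<union> B"
    using assms(1) unfolding pairing_def by blast
  then show "T \<inter> insert y A \<noteq> {} \<or> (\<exists>z\<in>T. f z \<in> T \<and> f z \<noteq> z \<and>
      z \<notin> insert y A \<union> insert x B \<and> f z \<notin> insert y A \<union> insert x B)"
  proof cases
    case 2
    have T': "T \<subseteq> board n" using T by (auto simp: transversal_def)
    show ?thesis
    proof (cases "y \<in> T")
      case False
      have "z \<noteq> x"
      proof
        assume "z = x"
        with 2 T' have "f x \<in> board n - insert x (A \<union> B)" by auto
        from assms(5)[OF this] show False using 2 False \<open>z = x\<close> by simp
      qed
      moreover have "f z \<noteq> x"
      proof
        assume "f z = x"
        then have "f x = z" using assms(2)[of z] by simp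
        with 2 T' \<open>f z = x\<close> have "f x \<in> board n - insert x (A \<union> B)" by auto
        from assms(5)[OF this] show False using 2 False \<open>f x = z\<close> by simp
      qed
      ultimately have "z \<notin> insert y A \<union> insert x B \<and> f z \<notin> insert y A \<union> insert x B"
        using 2 False by blast
      with 2 show ?thesis by blast
    qed auto
  qed auto
qed

text \<open>Induction on the number of free cells: the pairing survives an own move as well as a
  move of the opponent with its reply, and a pairing excludes a transversal in
  \<open>B\<close>.\<close>

lemma pairing_forces:
  assumes "pairing n f A B" "\<And>y. f (f y) = y"
  shows "forces n (\<lambda>A B. \<not> contains n B) t A B"
  using assms(1)
proof (induction "card (board n - (A \<union> B))" arbitrary: A B t rule: less_induct)
  case less
  have sub: "A \<union> B \<subseteq> board n" using less.prems by (simp add: pairing_def)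
  have dec: "card (board n - (A' \<union> B')) < card (board n - (A \<union> B))"
    if "A \<union> B \<subseteq> A' \<union> B'" "x \<in> board n - (A \<union> B)" "x \<in> A' \<union> B'" for x A' B'
    using that by (intro psubset_card_mono) auto
  have nc: "\<not> contains n B"
    using less.prems unfolding pairing_def contains_def by blast
  show ?case
  proof (cases "ended n A B")
    case True
    with nc show ?thesis by (intro over)
  next
    case nend: False
    then obtain x where x: "x \<in> board n - (A \<union> B)"
      using sub unfolding ended_def by blast
    show ?thesis
    proof (cases t)
      case True
      have "forces n (\<lambda>A B. \<not> contains n B) False (insert x A) B"
        using x by (intro less.hyps dec[of _ _ x] pairing_extra less.prems) auto
      then have "forces n (\<lambda>A B. \<not> contains n B) True A B"
          by (rule own[OF nend x])
        with True show ?thesis by simp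
    next
      case False
      have "forces n (\<lambda>A B. \<not> contains n B) True A (insert x B)"
        if x: "x \<in> board n - (A \<union> B)" for x
      proof (cases "ended n A (insert x B)")
        case True
        have "x \<notin> A" using x by simp
        then show ?thesis using True pairing_not_contains[OF less.prems] by (intro over)
      next
        case nend': False
        then obtain y0 where y0: "y0 \<in> board n - insert x (A \<union> B)"
          using sub x unfolding ended_def by blast
        define y where "y = (if f x \<in> board n - insert x (A \<union> B) then f x else y0)"
        have y: "y \<in> board n - insert x (A \<union> B)" using y0 by (auto simp: y_def)
        have "pairing n f (insert y A) (insert x B)"
          using less.prems assms(2) x y by (rule pairing_reply) (simp add: y_def)
        then have "forces n (\<lambda>A B. \<not> contains n B) False (insert y A) (insert x B)"
          using x by (intro less.hyps dec[of _ _ x]) auto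
        then show ?thesis using nend' y by (intro own[of _ _ _ y]) auto
      qed
      then have "forces n (\<lambda>A B. \<not> contains n B) False A B"
        by (rule opp[OF nend])
      with False show ?thesis by simp
    qed
  qed
qed


section \<open>Boards of size two and three by explicit pairings\<close>

lemma not_contains: "finite A \<Longrightarrow> card A < n \<Longrightarrow> \<not> contains n A"
  by (auto simp: contains_def transversal_def dest: card_mono)

lemma card_board: "card (board n) = n * n"
  by (simp add: board_def)

lemma not_ended:
  assumes "finite A" "finite B" "card A < n" "card B < n" "card A + card B < n * n"
  shows "\<not> ended n A B"
proof -
  have "card (A \<union> B) \<noteq> n * n" using card_Un_le[of A B] assms(5) by linarith
  then have "A \<union> B \<noteq> board n" using card_board[of n] by metis
  with assms show ?thesis by (simp add: ended_def not_contains)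
qed

lemma board_3: "board 3 = {0, 1, 2} \<times> {0, 1, 2}"
proof -
  have "{..<3} = {0, 1, 2 :: nat}" by auto
  then show ?thesis by (simp add: board_def)
qed

text \<open>Each pair is read in both directions; unlisted cells are fixed points and so belong to
  no pair.\<close>

definition swaps :: "(cell \<times> cell) list \<Rightarrow> cell \<Rightarrow> cell" where
  "swaps ps c = (case map_of (ps @ map prod.swap ps) c of None \<Rightarrow> c | Some d \<Rightarrow> d)"

definition lines2 :: "cell list list" where
  "lines2 = [[(0, 0), (1, 1)], [(0, 1), (1, 0)]]"

lemma transversal_2:
  assumes "transversal 2 T"
  shows "\<exists>l\<in>set lines2. set l \<subseteq> T"
proof -
  have "(0 :: nat) \<in> fst ` T" "(1 :: nat) \<in> fst ` T"
    using transversal_rows[OF assms] by auto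
  then obtain a b where ab: "(0, a) \<in> T" "(1, b) \<in> T" by auto
  then have "a \<noteq> b" using assms unfolding transversal_def by force
  moreover have "a < 2" "b < 2" using ab assms by (auto simp: transversal_def board_def)
  ultimately have "a = 0 \<and> b = 1 \<or> a = 1 \<and> b = 0" by linarith
  with ab show ?thesis by (auto simp: lines2_def)
qed

text \<open>One line per permutation of the columns. Explicit lists allow the conditions on pairings
  to be evaluated.\<close>

definition lines3 :: "cell list list" where
  "lines3 = map (zip [0, 1, 2]) [[0, 1, 2], [0, 2, 1], [1, 0, 2], [1, 2, 0], [2, 0, 1], [2, 1, 0]]"

lemma transversal_3:
  assumes "transversal 3 T"
  shows "\<exists>l\<in>set lines3. set l \<subseteq> T"
proof -
  have "(0 :: nat) \<in> fst ` T" "(1 :: nat) \<in> fst ` T" "(2 :: nat) \<in> fst ` T"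
    using transversal_rows[OF assms] by auto
  then obtain a b c where abc: "(0, a) \<in> T" "(1, b) \<in> T" "(2, c) \<in> T" by auto
  then have "a \<noteq> b" "a \<noteq> c" "b \<noteq> c" using assms unfolding transversal_def by force+
  moreover have "a < 3" "b < 3" "c < 3" using abc assms by (auto simp: transversal_def board_def)
  then have "a \<in> {0, 1, 2}" "b \<in> {0, 1, 2}" "c \<in> {0, 1, 2}" by auto
  ultimately have "set (zip [0, 1, 2] [a, b, c]) \<subseteq> T \<and> [a, b, c] \<in>
    set [[0, 1, 2], [0, 2, 1], [1, 0, 2], [1, 2, 0], [2, 0, 1], [2, 1, 0]]"
    using abc by auto
  then show ?thesis unfolding lines3_def by auto
qed

text \<open>An executable criterion for \<open>pairing\<close>: one distinctness test keeps the
  pairs disjoint from each other and from all claimed cells, and \<open>ls\<close> stands for the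
  transversals.\<close>

definition pairs_ok :: "nat \<Rightarrow> cell list list \<Rightarrow> cell list \<Rightarrow> cell list \<Rightarrow> (cell \<times> cell) list \<Rightarrow> bool" where
  "pairs_ok n ls A B ps \<longleftrightarrow> distinct (A @ B @ map fst ps @ map snd ps) \<and>
     list_all (\<lambda>(u, v). u < n \<and> v < n) (A @ B) \<and>
     list_all (\<lambda>l. list_ex (\<lambda>c. c \<in> set A) l \<or> list_ex (\<lambda>(c, d). c \<in> set l \<and> d \<in> set l) ps) ls"

text \<open>As no cell occurs twice, no entry of the combined list shadows another in
  \<open>map_of\<close>.\<close>

lemma map_of_swap:
  assumes "distinct (map fst ps @ map snd ps)"
  shows "map_of (ps @ map prod.swap ps) c = Some d \<longleftrightarrow> (c, d) \<in> set ps \<or> (d, c) \<in> set ps"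
proof -
  have *: "map fst (map prod.swap ps) = map snd ps" by simp
  have "distinct (map fst (ps @ map prod.swap ps))" using assms unfolding map_append * .
  from map_of_eq_Some_iff[OF this] show ?thesis by force
qed

lemma swaps_swaps:
  assumes "distinct (map fst ps @ map snd ps)"
  shows "swaps ps (swaps ps c) = c"
proof (cases "map_of (ps @ map prod.swap ps) c")
  case None
  then show ?thesis by (simp add: swaps_def del: map_of_append)
next
  case (Some d)
  then have "map_of (ps @ map prod.swap ps) d = Some c"
    using map_of_swap[OF assms] by blast
  with Some show ?thesis by (simp add: swaps_def del: map_of_append)
qed

lemma pairs_ok_forces:
  assumes ok: "pairs_ok n ls A B ps" and lines: "\<And>T. transversal n T \<Longrightarrow> \<exists>l\<in>set ls. set l \<subseteq> T"
  shows "forces n (\<lambda>A B. \<not> contains n B) t (set A) (set B)"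
proof (rule pairing_forces)
  have d: "distinct (map fst ps @ map snd ps)" using ok by (simp add: pairs_ok_def)
  show "swaps ps (swaps ps c) = c" for c by (rule swaps_swaps[OF d])
  show "pairing n (swaps ps) (set A) (set B)"
    unfolding pairing_def
  proof (intro conjI allI impI)
    show "set A \<inter> set B = {}" using ok by (auto simp: pairs_ok_def)
    show "set A \<union> set B \<subseteq> board n" using ok by (auto simp: pairs_ok_def board_def list_all_iff)
    fix T
    assume "transversal n T"
    then obtain l where l: "l \<in> set ls" "set l \<subseteq> T" using lines by blast
    then consider c where "c \<in> set l" "c \<in> set A"
      | c e where "(c, e) \<in> set ps" "c \<in> set l" "e \<in> set l"
      using ok unfolding pairs_ok_def list_all_iff list_ex_iff by blast
    then show "T \<inter> set A \<noteq> {} \<or> (\<exists>x\<in>T. swaps ps x \<in> T \<and> swaps ps x \<noteq> x \<and>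
        x \<notin> set A \<union> set B \<and> swaps ps x \<notin> set A \<union> set B)"
    proof cases
      case 1
      then show ?thesis using l by blast
    next
      case 2
      then have "map_of (ps @ map prod.swap ps) c = Some e" using map_of_swap[OF d] by blast
      then have "swaps ps c = e" by (simp add: swaps_def del: map_of_append)
      moreover have "c \<in> fst ` set ps" "e \<in> snd ` set ps" using 2(1) by force+
      then have "c \<noteq> e" "c \<notin> set A \<union> set B" "e \<notin> set A \<union> set B"
        using ok unfolding pairs_ok_def by auto
      moreover have "c \<in> T" "e \<in> T" using l 2 by auto
      ultimately show ?thesis by (intro disjI2 bexI[of _ c]) auto
    qed
  qed
qed

text \<open>The two transversals themselves are the pairs, so either player can spoil both, whether
  moving first or second.\<close>

lemma draw_2: "game_is_draw 2"
  unfolding game_is_draw_def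
proof
  fix p
  have "pairs_ok 2 lines2 [] [] [((0, 0), (1, 1)), ((0, 1), (1, 0))]"
    by code_simp
  from pairs_ok_forces[OF this transversal_2]
  have "forces 2 (\<lambda>A B. \<not> contains 2 B) (other p = PlayerX) {} {}" by simp
  then have "\<not> has_winning_strategy 2 (other (other p))"
    by (rule forces_not_lose)
  then show "\<not> has_winning_strategy 2 p" by simp
qed

lemma X_not_lose_3: "forces 3 (\<lambda>A B. \<not> contains 3 B) True {} {}"
proof (rule own)
  show "\<not> ended 3 {} {}" by (rule not_ended) auto
  show "(0, 0) \<in> board 3 - ({} \<union> {})" by (simp add: board_def)
  \<comment> \<open>Two of the six transversals pass through \<open>(0, 0)\<close>; each of the
    other four contains one of these pairs.\<close>
  have "pairs_ok 3 lines3 [(0, 0)] []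
    [((1, 0), (2, 2)), ((1, 1), (2, 0)), ((0, 1), (1, 2)), ((0, 2), (2, 1))]"
    by code_simp
  from pairs_ok_forces[OF this transversal_3]
  show "forces 3 (\<lambda>A B. \<not> contains 3 B) False {(0, 0)} {}" by simp
qed

text \<open>Addition modulo 3. Translations permute rows and columns cyclically and so preserve
  transversals, which is why one table can serve all nine first cells of X.\<close>

definition shift :: "cell \<Rightarrow> cell \<Rightarrow> cell" where
  "shift c d = ((fst c + fst d) mod 3, (snd c + snd d) mod 3)"

text \<open>
  All cells are relative to the first cell \<open>x\<close> of X, with O having answered at \<open>x + (1, 1)\<close>. An entry
  lists the second cell of X, the answer of O, and the pairs that O uses from then on. The table was
  found by exhaustive search.
\<close>

definition replies :: "(cell \<times> cell \<times> (cell \<times> cell) list) list" where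
  "replies =
    [((0, 1), (1, 2), [((0, 2), (2, 1)), ((1, 0), (2, 2))]),
     ((0, 2), (1, 0), [((0, 1), (2, 0)), ((1, 2), (2, 1))]),
     ((1, 0), (1, 2), [((0, 1), (2, 2)), ((0, 2), (2, 1))]),
     ((1, 2), (2, 1), [((0, 1), (2, 0)), ((1, 0), (2, 2))]),
     ((2, 0), (0, 1), [((0, 2), (1, 0)), ((1, 2), (2, 1))]),
     ((2, 1), (1, 2), [((0, 1), (2, 2)), ((0, 2), (1, 0))]),
     ((2, 2), (0, 1), [((0, 2), (1, 0)), ((1, 2), (2, 1))])]"

text \<open>Evaluation for each of the nine first cells takes the place of an invariance argument.
  The defender is O here, so the cells of O come first.\<close>

lemma replies_ok:
  "list_all (\<lambda>x. list_all (\<lambda>(d, e, ps).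
     pairs_ok 3 lines3 [shift x e, shift x (1, 1)] [shift x d, x] (map (map_prod (shift x) (shift x)) ps)) replies)
     (List.product [0, 1, 2] [0, 1, 2])"
  by code_simp

text \<open>The seven entries exhaust what X can play after the first two moves.\<close>

lemma replies_complete:
  "list_all (\<lambda>x. list_all (\<lambda>y. y = x \<or> y = shift x (1, 1) \<or> y \<in> set (map (shift x \<circ> fst) replies))
     (List.product [0, 1, 2] [0, 1, 2])) (List.product [0, 1, 2] [0, 1, 2])"
  by code_simp

lemma O_not_lose_3: "forces 3 (\<lambda>A B. \<not> contains 3 B) False {} {}"
proof (rule opp)
  show "\<not> ended 3 {} {}" by (rule not_ended) auto
  fix x
  assume "x \<in> board 3 - ({} \<union> {})"
  then have x: "x \<in> set (List.product [0, 1, 2] [0, 1, 2])" by (simp add: board_3)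
  define y where "y = shift x (1, 1)"
  have shift: "shift c d \<in> board 3" for c d by (simp add: shift_def board_def)
  have ok: "pairs_ok 3 lines3 [shift x e, y] [shift x d, x] (map (map_prod (shift x) (shift x)) ps)"
    if "(d, e, ps) \<in> set replies" for d e ps
  proof -
    from bspec[OF replies_ok[unfolded list_all_iff] x] that show ?thesis
      unfolding y_def by blast
  qed
  \<comment> \<open>Any entry would do: its distinctness test yields
    \<open>y \<noteq> x\<close>.\<close>
  have "pairs_ok 3 lines3 [shift x (1, 2), y] [shift x (0, 1), x]
    (map (map_prod (shift x) (shift x)) [((0, 2), (2, 1)), ((1, 0), (2, 2))])"
    by (rule ok) (simp add: replies_def)
  then have "y \<noteq> x" unfolding pairs_ok_def by auto
  show "forces 3 (\<lambda>A B. \<not> contains 3 B) True {} (insert x {})"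
  proof (rule own)
    show "\<not> ended 3 {} {x}" by (rule not_ended) auto
    show "y \<in> board 3 - ({} \<union> {x})" using \<open>y \<noteq> x\<close> by (simp add: y_def shift)
    show "forces 3 (\<lambda>A B. \<not> contains 3 B) False (insert y {}) {x}"
    proof (rule opp)
      show "\<not> ended 3 {y} {x}" by (rule not_ended) auto
      fix z
      assume z: "z \<in> board 3 - ({y} \<union> {x})"
      then have "z \<in> set (List.product [0, 1, 2] [0, 1, 2])" by (simp add: board_3)
      then have "z = x \<or> z = y \<or> z \<in> set (map (shift x \<circ> fst) replies)"
        unfolding y_def by (rule bspec[OF bspec[OF replies_complete[unfolded list_all_iff] x]])
      with z have "z \<in> (shift x \<circ> fst) ` set replies" by simp
      then obtain d e ps where r: "(d, e, ps) \<in> set replies" "z = shift x d"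
        unfolding image_iff by fastforce
      note o = ok[OF r(1), folded r(2)]
      show "forces 3 (\<lambda>A B. \<not> contains 3 B) True {y} (insert z {x})"
      proof (rule own)
        show "\<not> ended 3 {y} {z, x}" using z by (intro not_ended) auto
        show "shift x e \<in> board 3 - ({y} \<union> {z, x})"
          using o shift by (auto simp: pairs_ok_def)
        show "forces 3 (\<lambda>A B. \<not> contains 3 B) False (insert (shift x e) {y}) {z, x}"
          using pairs_ok_forces[OF o transversal_3, of False] by simp
      qed
    qed
  qed
qed

lemma draw_3: "game_is_draw 3"
  unfolding game_is_draw_def
proof
  fix p
  have "forces 3 (\<lambda>A B. \<not> contains 3 B) (other p = PlayerX) {} {}"
    using X_not_lose_3 O_not_lose_3 by (cases "other p") auto
  then have "\<not> has_winning_strategy 3 (other (other p))"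
    by (rule forces_not_lose)
  then show "\<not> has_winning_strategy 3 p" by simp
qed

section \<open>Boards of size at least four\<close>

text \<open>Non-attacking rooks, that is, a partial transversal with \<open>k\<close> cells; for
  \<open>k = n\<close> it is a transversal.\<close>

definition rook :: "nat \<Rightarrow> nat \<Rightarrow> cell set \<Rightarrow> bool" where
  "rook n k A \<longleftrightarrow> A \<subseteq> board n \<and> card A = k \<and> inj_on fst A \<and> inj_on snd A"

lemma rook_contains: "rook n n T \<Longrightarrow> T \<subseteq> A \<Longrightarrow> contains n A"
  by (auto simp: rook_def contains_def transversal_iff)

lemma rook_finite: "rook n k A \<Longrightarrow> finite A"
  by (auto simp: rook_def intro: finite_subset[OF _ finite_board])

lemma rook_insert:
  assumes "rook n k A" "r < n" "c < n" "r \<notin> fst ` A" "c \<notin> snd ` A"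
  shows "rook n (Suc k) (insert (r, c) A)"
proof -
  have "(r, c) \<notin> A" using assms(4) by force
  then have "card (insert (r, c) A) = Suc k"
    using assms(1) rook_finite[OF assms(1)] by (simp add: rook_def)
  moreover have "inj_on fst (insert (r, c) A)" "inj_on snd (insert (r, c) A)"
    using assms by (auto simp: rook_def inj_on_insert)
  ultimately show ?thesis using assms by (auto simp: rook_def board_def)
qed

lemma rook_exchange:
  assumes "rook n k A" "(i, j) \<in> A" "r < n" "r \<notin> fst ` A"
  shows "rook n k (insert (r, j) (A - {(i, j)}))"
    and "fst ` insert (r, j) (A - {(i, j)}) = insert r (fst ` A - {i})"
    and "snd ` insert (r, j) (A - {(i, j)}) = snd ` A"
proof -
  have inj: "inj_on fst A" "inj_on snd A" using assms(1) by (auto simp: rook_def)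
  have f: "fst ` (A - {(i, j)}) = fst ` A - {i}" "snd ` (A - {(i, j)}) = snd ` A - {j}"
    using inj_on_image_set_diff[OF inj(1), of A "{(i, j)}"]
      inj_on_image_set_diff[OF inj(2), of A "{(i, j)}"] assms(2) by auto
  have k: "card A = k" "finite A" using assms(1) rook_finite by (auto simp: rook_def)
  have "rook n (card (A - {(i, j)})) (A - {(i, j)})"
    using assms(1) inj by (auto simp: rook_def intro: inj_on_diff)
  moreover have "j < n" using assms(1,2) by (auto simp: rook_def board_def)
  ultimately have "rook n (Suc (card (A - {(i, j)}))) (insert (r, j) (A - {(i, j)}))"
    using assms(3,4) f by (intro rook_insert) auto
  then show "rook n k (insert (r, j) (A - {(i, j)}))"
    using card_Suc_Diff1[OF k(2) assms(2)] k(1) by simp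
  show "fst ` insert (r, j) (A - {(i, j)}) = insert r (fst ` A - {i})" using f by simp
  have "j \<in> snd ` A" using assms(2) by force
  have "snd ` insert (r, j) (A - {(i, j)}) = insert j (snd ` A - {j})" using f(2) by simp
  also have "\<dots> = snd ` A" using \<open>j \<in> snd ` A\<close> by (rule insert_Diff)
  finally show "snd ` insert (r, j) (A - {(i, j)}) = snd ` A" .
qed

text \<open>An augmenting path: \<open>(i, j)\<close> gives way to \<open>(r, j)\<close> and
  \<open>(i, c)\<close>, which cover the missing row and column.\<close>

lemma augment:
  assumes "rook n (n - 1) A" "(i, j) \<in> A" "r < n" "r \<notin> fst ` A" "c < n" "c \<notin> snd ` A"
    and "insert (i, c) (insert (r, j) (A - {(i, j)})) \<subseteq> W"
  shows "contains n W"
proof -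
  note e = rook_exchange[OF assms(1-4)]
  let ?A = "insert (r, j) (A - {(i, j)})"
  have "i \<noteq> r" using assms(2,4) by force
  then have "i \<notin> fst ` ?A" unfolding e(2) by simp
  moreover have "c \<notin> snd ` ?A" unfolding e(3) by fact
  moreover have "i < n" using assms(1,2) by (auto simp: rook_def board_def)
  ultimately have "rook n (Suc (n - 1)) (insert (i, c) ?A)"
    using assms(5) by (intro rook_insert[OF e(1)])
  moreover have "Suc (n - 1) = n" using assms(3) by simp
  ultimately show ?thesis using rook_contains[OF _ assms(7)] by simp
qed

text \<open>
  The moves are \<open>(r, j1)\<close>, answered by \<open>(i1, c)\<close>, and then \<open>(i2, c)\<close> with a double threat.
\<close>

lemma double_threat:
  assumes A: "rook n (n - 1) A" and rc: "r < n" "r \<notin> fst ` A" "c < n" "c \<notin> snd ` A"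
    and p: "(i1, j1) \<in> A" "(i2, j2) \<in> A" "(i1, j1) \<noteq> (i2, j2)"
    and disj: "A \<inter> B = {}" and rcB: "(r, c) \<in> B"
    and free: "(r, j1) \<notin> B" "(i1, c) \<notin> B" "(i2, c) \<notin> B" "(r, j2) \<notin> B" "(i1, j2) \<notin> B"
    and nowin: "\<And>z. z \<notin> A \<Longrightarrow> \<not> contains n (insert z (insert (i1, c) B))"
  shows "forces n (\<lambda>A B. contains n A) True A B"
proof -
  have nowin': "\<not> contains n (insert z B)" if "z \<notin> A" for z
    using nowin[OF that] contains_mono[of n "insert z B" "insert z (insert (i1, c) B)"] by auto
  have inj: "inj_on fst A" "inj_on snd A" using A by (auto simp: rook_def)
  have ij: "i1 < n" "j1 < n" "i2 < n" "j2 < n" using A p by (auto simp: rook_def board_def)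
  have ne: "i1 \<noteq> r" "i2 \<noteq> r" "j1 \<noteq> c" "j2 \<noteq> c" using p rc by force+
  have ne': "i1 \<noteq> i2" "j1 \<noteq> j2" using inj_onD[OF inj(1) _ p(1,2)] inj_onD[OF inj(2) _ p(1,2)] p(3) by auto
  have notA: "(r, k) \<notin> A" "(k, c) \<notin> A" for k using rc by force+
  have notA': "(i1, j2) \<notin> A" using inj_onD[OF inj(1) _ p(1), of "(i1, j2)"] ne' by auto
  define A1 where "A1 = insert (r, j1) A"
  define B1 where "B1 = insert (i1, c) B"
  define A2 where "A2 = insert (i2, c) A1"
  have now1: "contains n (insert (i1, c) A1)"
    by (rule augment[OF A p(1) rc]) (auto simp: A1_def)
  have now2: "contains n (insert (r, j2) A2)"
    by (rule augment[OF A p(2) rc]) (auto simp: A1_def A2_def)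
  \<comment> \<open>A longer augmenting path: \<open>(r, j1)\<close> replaces
    \<open>(i1, j1)\<close>, and then \<open>(i1, j2)\<close> and \<open>(i2, c)\<close> replace
    \<open>(i2, j2)\<close>.\<close>
  have now3: "contains n (insert (i1, j2) A2)"
  proof -
    note e = rook_exchange[OF A p(1) rc(1,2)]
    have "i1 \<notin> fst ` insert (r, j1) (A - {(i1, j1)})" unfolding e(2) using ne by simp
    moreover have "c \<notin> snd ` insert (r, j1) (A - {(i1, j1)})" unfolding e(3) by (rule rc)
    ultimately show ?thesis
      using p ij rc by (intro augment[OF e(1), of i2 j2 i1 c]) (auto simp: A1_def A2_def)
  qed
  have last: "forces n (\<lambda>A B. contains n A) False A2 B1"
  proof (rule forces_opp)
    \<comment> \<open>Since \<open>(r, c)\<close> is already in \<open>B\<close>, inserting it in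
      \<open>nowin\<close> leaves \<open>B1\<close> itself.\<close>
    have "(r, c) \<notin> A" by (rule notA)
    then show "\<not> contains n B1" using nowin[of "(r, c)"] rcB by (simp add: B1_def insert_absorb)
    show r2: "(r, j2) \<in> board n - (A2 \<union> B1)"
      using rc ij ne ne' notA free by (auto simp: A1_def A2_def B1_def board_def)
    have r3: "(i1, j2) \<in> board n - (A2 \<union> B1)"
      using rc ij ne ne' notA' free by (auto simp: A1_def A2_def B1_def board_def)
    fix z
    assume z: "z \<in> board n - (A2 \<union> B1)"
    then have nc: "\<not> contains n (insert z B1)"
      unfolding B1_def by (intro nowin) (auto simp: A1_def A2_def)
    show "forces n (\<lambda>A B. contains n A) True A2 (insert z B1)"
    \<comment> \<open>One O cell cannot block both threats; X completes at the other.\<close>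
    proof (cases "z = (r, j2)")
      case True
      then show ?thesis using nc r3 now3 ne by (intro forces_now[of _ _ "(i1, j2)"]) auto
    next
      case False
      then show ?thesis using nc r2 now2 by (intro forces_now[of _ _ "(r, j2)"]) auto
    qed
  qed
  have B: "\<not> contains n B" using nowin'[of "(r, c)"] rcB notA by (simp add: insert_absorb)
  show ?thesis
  proof (rule forces_own[OF B])
    show "(r, j1) \<in> board n - (A \<union> B)" using rc ij notA free by (auto simp: board_def)
    show "forces n (\<lambda>A B. contains n A) False (insert (r, j1) A) B"
      unfolding A1_def[symmetric]
    proof (rule forces_opp[OF B])
      show f1: "(i1, c) \<in> board n - (A1 \<union> B)"
        using rc ij ne notA free by (auto simp: board_def A1_def)
      fix z
      assume z: "z \<in> board n - (A1 \<union> B)"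
      then have nc: "\<not> contains n (insert z B)" by (intro nowin') (auto simp: A1_def)
      show "forces n (\<lambda>A B. contains n A) True A1 (insert z B)"
      \<comment> \<open>Unless O blocks at \<open>(i1, c)\<close>, X wins there at once.\<close>
      proof (cases "z = (i1, c)")
        case True
        have "(i2, c) \<in> board n - (A1 \<union> B1)"
          using rc ij ne ne' notA free by (auto simp: board_def A1_def B1_def)
        with True nc last show ?thesis
          unfolding A2_def by (intro forces_own[of _ _ "(i2, c)"]) (auto simp: B1_def)
      next
        case False
        then show ?thesis using nc f1 now1 by (intro forces_now[of _ _ "(i1, c)"]) auto
      qed
    qed
  qed
qed

text \<open>Rows and columns of \<open>A\<close> are distinct, so different pairs
  \<open>(p, q)\<close> give different crossing cells. There are
  \<open>card P * (card Q - 1)\<close> of them, more than \<open>B\<close> can cover.\<close>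

lemma choose_pair:
  assumes "rook n k A" "P \<subseteq> A" "Q \<subseteq> A" "P \<subseteq> Q" "finite B" "card B < card P * (card Q - 1)"
  obtains p q where "p \<in> P" "q \<in> Q" "p \<noteq> q" "(fst p, snd q) \<notin> B"
proof -
  let ?S = "SIGMA p:P. Q - {p}"
  let ?g = "\<lambda>(p, q). (fst p, snd q) :: cell"
  have fin: "finite P" "finite Q" using assms(2,3) rook_finite[OF assms(1)] finite_subset by auto
  have inj: "inj_on fst A" "inj_on snd A" using assms(1) by (auto simp: rook_def)
  have "inj_on ?g ?S"
    using inj_on_subset[OF inj(1) assms(2)] inj_on_subset[OF inj(2) assms(3)]
    by (auto simp: inj_on_def)
  then have "card (?g ` ?S) = card ?S" by (rule card_image)
  also have "\<dots> = (\<Sum>p\<in>P. card (Q - {p}))" using fin by (simp add: card_SigmaI)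
  also have "\<dots> = (\<Sum>p\<in>P. card Q - 1)" using assms(4) by (intro sum.cong card_Diff_singleton) auto
  also have "\<dots> = card P * (card Q - 1)" by simp
  finally have "\<not> ?g ` ?S \<subseteq> B" using assms(5,6) card_mono[of B "?g ` ?S"] by linarith
  then show ?thesis using that by force
qed

lemma card_insert_le_Suc: "card (insert x A) \<le> Suc (card A)"
  by (cases "finite A") (auto simp: card_insert_if)

lemma transversal_line:
  assumes "transversal n T" "\<And>x y. x \<in> D \<Longrightarrow> y \<in> D \<Longrightarrow> fst x = fst y \<or> snd x = snd y" "finite D"
  shows "card (T \<inter> D) \<le> 1"
proof -
  have "x = y" if "x \<in> T \<inter> D" "y \<in> T \<inter> D" for x y
    using that assms(1) assms(2)[of x y] unfolding transversal_def by blast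
  then show ?thesis using assms(3) by (simp add: card_le_Suc0_iff_eq)
qed

definition lines :: "nat set \<Rightarrow> nat set \<Rightarrow> cell set \<Rightarrow> cell set" where
  "lines R C B = {b \<in> B. fst b \<in> R \<or> snd b \<in> C}"

text \<open>Such a pair costs the owner of \<open>B\<close> a cell, as a transversal uses at most
  one of the two.\<close>

definition clash :: "cell set \<Rightarrow> bool" where
  "clash B \<longleftrightarrow> (\<exists>b\<in>B. \<exists>b'\<in>B. b \<noteq> b' \<and> (fst b = fst b' \<or> snd b = snd b'))"

text \<open>
  In each alternative of \<open>extra\<close> the \<open>n + 1\<close> cells that O gets contain no transversal: there are three
  O cells in column \<open>c\<close>, or two in column \<open>c\<close> and another two on a common line, or the row and the
  column of \<open>y\<close> contain at most one O cell in total, which is not their intersection.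
\<close>

lemma endgame_col:
  assumes n: "n \<ge> 4" and A: "rook n (n - 1) A"
    and rc: "r < n" "r \<notin> fst ` A" "c < n" "c \<notin> snd ` A"
    and B: "B \<subseteq> board n" "A \<inter> B = {}" "card B = n - 2" "(r, c) \<notin> B"
    and row: "\<And>b. b \<in> B \<Longrightarrow> fst b \<noteq> r" and col: "card {b \<in> B. snd b = c} \<le> 1"
    and extra: "{b \<in> B. snd b = c} \<noteq> {} \<or> clash B \<or> (\<exists>y\<in>A. lines {fst y} {snd y} B = {})"
  shows "forces n (\<lambda>A B. contains n A) True A (insert (r, c) B)"
proof -
  have fin: "finite B" "finite A" using finite_subset[OF B(1)] rook_finite[OF A] by simp_all
  have inj: "inj_on fst A" using A by (simp add: rook_def)
  have cA: "card A = n - 1" using A by (simp add: rook_def)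
  have rcA: "(r, c) \<notin> A" using rc by force
  \<comment> \<open>\<open>p1\<close> and \<open>p2\<close> will be \<open>(i1, j1)\<close> and
    \<open>(i2, j2)\<close> of \<open>double_threat\<close>; freedom of the cells in row
    \<open>r\<close> comes from \<open>row\<close>.\<close>
  have "\<exists>p1\<in>A. \<exists>p2\<in>A. p1 \<noteq> p2 \<and> (fst p1, c) \<notin> B \<and> (fst p2, c) \<notin> B \<and> (fst p1, snd p2) \<notin> B \<and>
      (\<forall>z. z \<notin> A \<longrightarrow> \<not> contains n (insert z (insert (fst p1, c) (insert (r, c) B))))"
  proof (cases "{b \<in> B. snd b = c} = {}")
    case False
    then obtain a where a: "(a, c) \<in> B" by auto
    have "\<forall>x\<in>{b \<in> B. snd b = c}. \<forall>y\<in>{b \<in> B. snd b = c}. x = y"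
      using col card_le_Suc0_iff_eq[of "{b \<in> B. snd b = c}"] fin by simp
    with a have only: "b = (a, c)" if "b \<in> B" "snd b = c" for b
      using that by (cases b) simp
    have a': "a \<noteq> r" "a < n" using a B by (auto simp: board_def)
    have "fst ` A = {..<n} - {r}"
    proof (rule card_subset_eq)
      show "fst ` A \<subseteq> {..<n} - {r}" using A rc by (auto simp: rook_def board_def)
      show "card (fst ` A) = card ({..<n} - {r})" using inj cA rc by (simp add: card_image)
    qed simp
    then obtain q where q: "q \<in> A" "fst q = a" using a' by (metis DiffI imageE lessThan_iff singletonD)
    have cP: "card (A - {q}) = n - 2" using q cA by simp
    have cB: "card (B - {(a, c)}) = n - 3" using a B(3) by simp
    have "n - 3 < (n - 2) * (n - 2 - 1)" proof -
      obtain m where "n = m + 4" using n by (metis add.commute le_Suc_ex)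
      then show ?thesis by simp
    qed
    with cP cB have "card (B - {(a, c)}) < card (A - {q}) * (card (A - {q}) - 1)" by simp
    moreover have "finite (B - {(a, c)})" using fin by simp
    ultimately obtain p1 p2
      where p: "p1 \<in> A - {q}" "p2 \<in> A - {q}" "p1 \<noteq> p2" "(fst p1, snd p2) \<notin> B - {(a, c)}"
      using choose_pair[OF A Diff_subset Diff_subset subset_refl] by blast
    have pa: "fst p1 \<noteq> a" "fst p2 \<noteq> a" using inj_onD[OF inj _ _ q(1), of p1] inj_onD[OF inj _ _ q(1), of p2] p q(2) by auto
    have pr: "fst p1 \<noteq> r" "snd p2 \<noteq> c" using p rc by auto
    have "\<not> contains n (insert z (insert (fst p1, c) (insert (r, c) B)))" for z
    proof
      let ?W = "insert z (insert (fst p1, c) (insert (r, c) B))"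
      \<comment> \<open>Of at most \<open>n + 1\<close> O cells, three share column
        \<open>c\<close>, so a transversal can use at most \<open>n - 1\<close>.\<close>
      let ?D = "{(fst p1, c), (r, c), (a, c)}"
      assume "contains n ?W"
      then obtain T where T: "transversal n T" "T \<subseteq> ?W" by (auto simp: contains_def)
      have "card ?D = 3" using pa pr a' by auto
      moreover have "card ?W \<le> n + 1"
        using B(3) n card_insert_le_Suc[of "(r, c)" B]
          card_insert_le_Suc[of "(fst p1, c)" "insert (r, c) B"]
          card_insert_le_Suc[of z "insert (fst p1, c) (insert (r, c) B)"] by linarith
      moreover have "?D \<subseteq> ?W" using a by auto
      ultimately have "card (?W - ?D) \<le> n - 2" using fin by (simp add: card_Diff_subset)
      moreover have "card (T \<inter> ?D) \<le> 1" by (rule transversal_line[OF T(1)]) auto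
      moreover have "card T \<le> card ((?W - ?D) \<union> (T \<inter> ?D))"
        using T(2) fin by (intro card_mono) auto
      moreover have "card T = n" using T(1) by (simp add: transversal_def)
      ultimately show False using card_Un_le[of "?W - ?D" "T \<inter> ?D"] n by linarith
    qed
    moreover have "(fst p1, c) \<notin> B" "(fst p2, c) \<notin> B" "(fst p1, snd p2) \<notin> B"
      using only[of "(fst p1, c)"] only[of "(fst p2, c)"] p(4) pa pr by auto
    ultimately show ?thesis using p by blast
  next
    case True
    then have noc: "snd b \<noteq> c" if "b \<in> B" for b using that by blast
    have "A \<noteq> {}" using cA n by auto
    obtain y where y: "y \<in> A" "clash B \<or> lines {fst y} {snd y} B = {}"
      using extra True \<open>A \<noteq> {}\<close> by blast
    \<comment> \<open>\<open>p1\<close> must avoid \<open>y\<close>, because O will be driven to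
      column \<open>c\<close> in the row of \<open>p1\<close>, and the row of \<open>y\<close>
      should stay empty.\<close>
    have cP: "card (A - {y}) = n - 2" using y cA by simp
    have "n - 2 < (n - 2) * (n - 1 - 1)" using n by simp
    with cP cA B(3) have "card B < card (A - {y}) * (card A - 1)" by simp
    then obtain p1 p2
      where p: "p1 \<in> A - {y}" "p2 \<in> A" "p1 \<noteq> p2" "(fst p1, snd p2) \<notin> B"
      using choose_pair[OF A Diff_subset subset_refl Diff_subset fin(1)] by blast
    have py: "fst p1 \<noteq> fst y" using inj_onD[OF inj _ _ y(1), of p1] p by auto
    have pr: "fst p1 \<noteq> r" "r \<noteq> fst y" "c \<noteq> snd y" using p y rc by auto
    have "\<not> contains n (insert z (insert (fst p1, c) (insert (r, c) B)))" if z: "z \<notin> A" for z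
    proof
      let ?W = "insert z (insert (fst p1, c) (insert (r, c) B))"
      assume "contains n ?W"
      then obtain T where T: "transversal n T" "T \<subseteq> ?W" by (auto simp: contains_def)
      from y(2) show False
      proof
        assume "lines {fst y} {snd y} B = {}"
        then have e: "fst b \<noteq> fst y" "snd b \<noteq> snd y" if "b \<in> B" for b
          using that unfolding lines_def by blast+
        have yn: "fst y < n" "snd y < n" using y A by (auto simp: rook_def board_def)
        \<comment> \<open>A transversal meets both the row and the column of \<open>y\<close>, where
          O can own only \<open>z\<close>. Hence \<open>z = y\<close>, a cell of X.\<close>
        obtain s where s: "s \<in> T" "fst s = fst y" using transversal_rows[OF T(1)] yn
          by (metis imageE lessThan_iff)
        obtain t where t: "t \<in> T" "snd t = snd y" using transversal_cols[OF T(1)] yn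
          by (metis imageE lessThan_iff)
        have "s \<notin> B" "t \<notin> B" using e s(2) t(2) by blast+
        moreover have "s \<noteq> (fst p1, c)" "s \<noteq> (r, c)" using s(2) py pr by auto
        moreover have "t \<noteq> (fst p1, c)" "t \<noteq> (r, c)" using t(2) pr by auto
        ultimately have "s = z" "t = z" using s(1) t(1) T(2) by blast+
        then have "z = y" using s t by (simp add: prod_eq_iff)
        with z y show False by simp
      next
        assume "clash B"
        then obtain b b' where b: "b \<in> B" "b' \<in> B" "b \<noteq> b'" "fst b = fst b' \<or> snd b = snd b'"
          unfolding clash_def by blast
        \<comment> \<open>Two disjoint collinear pairs waste two of at most \<open>n + 1\<close>
          cells.\<close>
        let ?D = "{(fst p1, c), (r, c)}" and ?E = "{b, b'}"
        have d: "?D \<inter> ?E = {}" using noc[OF b(1)] noc[OF b(2)] by auto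
        have "card (?D \<union> ?E) = 4" using d b(3) pr by (subst card_Un_disjoint) auto
        moreover have "card ?W \<le> n + 1"
          using B(3) n card_insert_le_Suc[of "(r, c)" B]
            card_insert_le_Suc[of "(fst p1, c)" "insert (r, c) B"]
            card_insert_le_Suc[of z "insert (fst p1, c) (insert (r, c) B)"] by linarith
        moreover have "?D \<union> ?E \<subseteq> ?W" using b by auto
        ultimately have "card (?W - (?D \<union> ?E)) \<le> n - 3" using fin by (subst card_Diff_subset) auto
        moreover have "card (T \<inter> ?D) \<le> 1" by (rule transversal_line[OF T(1)]) auto
        moreover have "card (T \<inter> ?E) \<le> 1" by (rule transversal_line[OF T(1)]) (use b in auto)
        moreover have "card T \<le> card ((?W - (?D \<union> ?E)) \<union> ((T \<inter> ?D) \<union> (T \<inter> ?E)))"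
          using T(2) fin by (intro card_mono) auto
        moreover have "card T = n" using T(1) by (simp add: transversal_def)
        ultimately show False
          using card_Un_le[of "?W - (?D \<union> ?E)" "(T \<inter> ?D) \<union> (T \<inter> ?E)"]
            card_Un_le[of "T \<inter> ?D" "T \<inter> ?E"] n by linarith
      qed
    qed
    moreover have "(fst p1, c) \<notin> B" "(fst p2, c) \<notin> B"
      using noc[of "(fst p1, c)"] noc[of "(fst p2, c)"] by auto
    ultimately show ?thesis using p by blast
  qed
  then obtain p1 p2 where p: "p1 \<in> A" "p2 \<in> A" "p1 \<noteq> p2" "(fst p1, c) \<notin> B" "(fst p2, c) \<notin> B"
    "(fst p1, snd p2) \<notin> B"
    "\<And>z. z \<notin> A \<Longrightarrow> \<not> contains n (insert z (insert (fst p1, c) (insert (r, c) B)))" by blast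
  have "fst p1 \<noteq> r" "fst p2 \<noteq> r" "snd p1 \<noteq> c" "snd p2 \<noteq> c" using p(1,2) rc by auto
  moreover have "(r, snd p1) \<notin> B" "(r, snd p2) \<notin> B"
    using row[of "(r, snd p1)"] row[of "(r, snd p2)"] by auto
  ultimately show ?thesis
    using p(1-6) B(2) rcA
    by (intro double_threat[OF A rc, of "fst p1" "snd p1" "fst p2" "snd p2"] p(7)) auto
qed

section \<open>Transposing the board\<close>

lemma swap_board: "prod.swap ` board n = board n"
  by (auto simp: board_def)

lemma swap_image_iff: "prod.swap x \<in> prod.swap ` A \<longleftrightarrow> x \<in> A"
  by (rule inj_image_mem_iff) simp

lemma swap_swap_image: "prod.swap ` prod.swap ` A = A"
  by (simp add: image_image)

lemma transversal_swap:
  assumes "transversal n T"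
  shows "transversal n (prod.swap ` T)"
proof -
  have "card (prod.swap ` T) = card T" by (simp add: card_image)
  then show ?thesis using assms unfolding transversal_def by (auto simp: board_def)
qed

lemma contains_swap: "contains n (prod.swap ` A) \<longleftrightarrow> contains n A"
proof -
  have swap: "contains n (prod.swap ` A)" if A: "contains n A" for A
  proof -
    obtain T where "transversal n T" "T \<subseteq> A" using A by (auto simp: contains_def)
    then have "transversal n (prod.swap ` T)" "prod.swap ` T \<subseteq> prod.swap ` A"
      by (simp_all add: transversal_swap image_mono)
    then show ?thesis unfolding contains_def by blast
  qed
  from swap[of "prod.swap ` A"] swap[of A] show ?thesis
    unfolding swap_swap_image by (rule iffI)
qed

lemma ended_swap: "ended n (prod.swap ` A) (prod.swap ` B) \<longleftrightarrow> ended n A B"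
proof -
  have "prod.swap ` A \<union> prod.swap ` B = board n \<longleftrightarrow> prod.swap ` (A \<union> B) = prod.swap ` board n"
    by (simp add: image_Un swap_board)
  also have "\<dots> \<longleftrightarrow> A \<union> B = board n" by (simp add: inj_image_eq_iff)
  finally show ?thesis by (simp add: ended_def contains_swap)
qed

lemma swap_free: "x \<in> board n - (prod.swap ` A \<union> prod.swap ` B) \<longleftrightarrow> prod.swap x \<in> board n - (A \<union> B)"
  using swap_image_iff[of x "board n"] swap_image_iff[of "prod.swap x" A] swap_image_iff[of "prod.swap x" B]
  by (simp add: swap_board)

text \<open>Transposition preserves free cells, transversals and the end of the game, so a whole
  derivation can be transposed.\<close>

lemma forces_swap:
  assumes "forces n (\<lambda>A B. contains n A) t A B"
  shows "forces n (\<lambda>A B. contains n A) t (prod.swap ` A) (prod.swap ` B)"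
  using assms
proof induction
  case (over A B t)
  then show ?case by (intro forces.over) (simp_all add: ended_swap contains_swap)
next
  case (own A B x)
  have "prod.swap x \<in> board n - (prod.swap ` A \<union> prod.swap ` B)"
    unfolding swap_free using own.hyps by simp
  with own show ?case by (intro forces.own[of _ _ _ "prod.swap x"]) (simp_all add: ended_swap)
next
  case (opp A B)
  show ?case
  proof (rule forces.opp)
    show "\<not> ended n (prod.swap ` A) (prod.swap ` B)" using opp.hyps(1) by (simp add: ended_swap)
    fix x
    assume "x \<in> board n - (prod.swap ` A \<union> prod.swap ` B)"
    then have "prod.swap x \<in> board n - (A \<union> B)" unfolding swap_free .
    from opp.IH[OF this] show "forces n (\<lambda>A B. contains n A) True (prod.swap ` A) (insert x (prod.swap ` B))"
      by simp
  qed
qed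

lemma lines_swap: "lines R C (prod.swap ` B) = prod.swap ` lines C R B"
  by (auto simp: lines_def)

lemma clash_swap: "clash (prod.swap ` B) \<longleftrightarrow> clash B"
  by (simp add: clash_def inj_eq disj_commute)

lemma rook_swap: "rook n k A \<Longrightarrow> rook n k (prod.swap ` A)"
  using card_image[OF inj_swap, of A] unfolding rook_def
  by (auto simp: inj_on_def board_def)

text \<open>At most one O cell lies on the lines of \<open>(r, c)\<close>. If row \<open>r\<close>
  is free of O, \<open>endgame_col\<close> applies directly; otherwise column \<open>c\<close> is,
  and transposition reduces to it.\<close>

lemma endgame:
  assumes n: "n \<ge> 4" and A: "rook n (n - 1) A"
    and rc: "r < n" "r \<notin> fst ` A" "c < n" "c \<notin> snd ` A"
    and B: "B \<subseteq> board n" "A \<inter> B = {}" "card B = n - 2" "(r, c) \<notin> B"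
    and lines: "card (lines {r} {c} B) \<le> 1"
    and extra: "lines {r} {c} B \<noteq> {} \<or> clash B \<or> (\<exists>y\<in>A. lines {fst y} {snd y} B = {})"
  shows "forces n (\<lambda>A B. contains n A) True A (insert (r, c) B)"
proof -
  have "finite B" using finite_subset[OF B(1)] by simp
  then have fin: "finite (lines {r} {c} B)" by (simp add: lines_def)
  have one: "b = b'" if "b \<in> lines {r} {c} B" "b' \<in> lines {r} {c} B" for b b'
    using that lines fin by (simp add: card_le_Suc0_iff_eq)
  show ?thesis
  proof (cases "\<exists>b\<in>B. fst b = r")
    case False
    then have "lines {r} {c} B = {b \<in> B. snd b = c}" by (auto simp: lines_def)
    with False lines extra show ?thesis by (intro endgame_col[OF n A rc B]) simp_all
  next
    case True
    then obtain b where b: "b \<in> B" "fst b = r" by blast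
    have noc: "snd b' \<noteq> c" if "b' \<in> B" for b'
    proof
      assume "snd b' = c"
      with that b have "b = b'" by (intro one) (simp_all add: lines_def)
      with b \<open>snd b' = c\<close> have "b = (r, c)" by (simp add: prod_eq_iff)
      with b B(4) show False by simp
    qed
    then have L: "lines {r} {c} B = {b \<in> B. fst b = r}" by (auto simp: lines_def)
    let ?s = "image prod.swap :: cell set \<Rightarrow> cell set"
    have S: "{b \<in> ?s B. snd b = r} = ?s {b \<in> B. fst b = r}" by auto
    have "forces n (\<lambda>A B. contains n A) True (?s A) (insert (c, r) (?s B))"
    proof (rule endgame_col[OF n rook_swap[OF A]])
      show "c < n" "r < n" by (fact rc)+
      show "c \<notin> fst ` ?s A" "r \<notin> snd ` ?s A" using rc by (simp_all add: image_image)
      show "?s B \<subseteq> board n" using image_mono[OF B(1), of prod.swap] by (simp add: swap_board)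
      show "?s A \<inter> ?s B = {}" using B(2) by (auto simp flip: image_Int)
      show "card (?s B) = n - 2" using B(3) by (simp add: card_image)
      show "(c, r) \<notin> ?s B" using B(4) by auto
      show "fst b' \<noteq> c" if "b' \<in> ?s B" for b'
        using that by (auto dest: noc)
      show "card {b \<in> ?s B. snd b = r} \<le> 1" unfolding S using lines L by (simp add: card_image)
      show "{b \<in> ?s B. snd b = r} \<noteq> {} \<or> clash (?s B) \<or> (\<exists>y\<in>?s A. lines {fst y} {snd y} (?s B) = {})"
        \<comment> \<open>The O cell \<open>b\<close> in row \<open>r\<close> lands in the
          distinguished column after transposition and gives the first alternative.\<close>
        unfolding S using b by blast
    qed
    from forces_swap[OF this] show ?thesis by (simp add: swap_swap_image)
  qed
qed

text \<open>
  The last condition is the hypothesis \<open>extra\<close> of the endgame, needed when only one cell is left.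
\<close>

definition good :: "nat set \<Rightarrow> nat set \<Rightarrow> cell set \<Rightarrow> cell \<Rightarrow> bool" where
  "good R C B y \<longleftrightarrow> y \<in> R \<times> C - B \<and> B \<inter> (R - {fst y}) \<times> (C - {snd y}) = {} \<and>
     card (lines (R - {fst y}) (C - {snd y}) B) \<le> 1 \<and>
     (lines (R - {fst y}) (C - {snd y}) B \<noteq> {} \<or> clash B \<or> lines {fst y} {snd y} B = {})"

lemma good_swap: "good R C (prod.swap ` B) y \<Longrightarrow> good C R B (prod.swap y)"
proof -
  assume g: "good R C (prod.swap ` B) y"
  have i: "prod.swap ` B \<inter> (R - {fst y}) \<times> (C - {snd y}) = {} \<longleftrightarrow>
    B \<inter> (C - {snd y}) \<times> (R - {fst y}) = {}" by fastforce
  have m: "y \<in> R \<times> C - prod.swap ` B \<longleftrightarrow> prod.swap y \<in> C \<times> R - B"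
    using swap_image_iff[of "prod.swap y" B] by (cases y) auto
  show ?thesis
    using g unfolding good_def i m lines_swap clash_swap by (simp add: card_image)
qed

text \<open>An O cell inside the smaller subboard would lie on its lines, hence be \<open>w\<close>.
  The presence of \<open>w\<close> also settles the last condition.\<close>

lemma good_single:
  assumes "y \<in> R \<times> C - B" "lines (R - {fst y}) (C - {snd y}) B = {w}"
    "w \<notin> (R - {fst y}) \<times> (C - {snd y})"
  shows "good R C B y"
proof -
  have "B \<inter> (R - {fst y}) \<times> (C - {snd y}) \<subseteq> lines (R - {fst y}) (C - {snd y}) B"
    by (auto simp: lines_def)
  then have "B \<inter> (R - {fst y}) \<times> (C - {snd y}) = {}"
    using assms(2,3) by (metis IntD2 singletonI subset_singletonD)
  with assms show ?thesis by (simp add: good_def)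
qed

lemma card_ge_2_other:
  assumes "card (S :: nat set) \<ge> 2"
  obtains s' where "s' \<in> S" "s' \<noteq> s"
proof -
  have "\<not> S \<subseteq> {s}" using card_mono[of "{s}" S] assms by auto
  then show ?thesis using that by blast
qed

lemma lines_empty: "lines R C {} = {}"
  by (simp add: lines_def)

lemma lines_insert:
  "lines R C (insert x B) = (if fst x \<in> R \<or> snd x \<in> C then insert x (lines R C B) else lines R C B)"
  by (auto simp: lines_def)

lemma lines_sub: "lines (R - R') (C - C') B = lines (R - R') (C - C') (lines R C B)"
  by (auto simp: lines_def)

text \<open>As a rule X answers in column \<open>v\<close>: this takes \<open>(u, v)\<close> off the
  remaining lines and leaves \<open>x\<close> as the only O cell there.\<close>

lemma good_move_col:
  assumes card: "card R \<ge> 2" "card C \<ge> 2" and B: "lines R C B = {(u, v)}" "u \<notin> R" "v \<in> C" "x \<notin> B"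
  shows "\<exists>y. good R C (insert x B) y"
proof -
  obtain a b where x: "x = (a, b)" by (cases x)
  have uv: "(u, v) \<in> B" using B(1) by (auto simp: lines_def)
  have free: "y \<notin> B" if "y \<in> R \<times> C" for y
  proof
    assume "y \<in> B"
    with that have "y \<in> lines R C B" by (auto simp: lines_def)
    with B that show False by auto
  qed
  have sub: "lines (R - R') (C - C') B = lines (R - R') (C - C') {(u, v)}" for R' C'
    using lines_sub[of R R' C C' B] B(1) by simp
  obtain a' where a': "a' \<in> R" "a' \<noteq> a" using card_ge_2_other[OF card(1)] .
  obtain b' where b': "b' \<in> C" "b' \<noteq> v" using card_ge_2_other[OF card(2)] .
  consider "a \<in> R" "b \<in> C" "b \<noteq> v" | "a \<in> R" "b = v" | "a \<notin> R" "b \<in> C" "b \<noteq> v"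
    | "a \<notin> R" "b = v" | "a \<in> R" "b \<notin> C" | "a \<notin> R" "b \<notin> C" by blast
  then show ?thesis
  proof cases
    case 1
    \<comment> \<open>Row \<open>a\<close> is used up to expel \<open>x\<close> from the subboard;
      \<open>x\<close> remains on column \<open>b\<close>.\<close>
    have "good R C (insert x B) (a, v)"
      using 1 B(2-4) free[of "(a, v)"] by (intro good_single[of _ _ _ _ x]) (auto simp: x lines_insert sub lines_empty)
    then show ?thesis by blast
  next
    case 2
    have "good R C (insert x B) (a', v)"
      using 2 a' B(2-4) free[of "(a', v)"] by (intro good_single[of _ _ _ _ x]) (auto simp: x lines_insert sub lines_empty)
    then show ?thesis by blast
  next
    case 3
    have "good R C (insert x B) (a', v)"
      using 3 a' B(2-4) free[of "(a', v)"] by (intro good_single[of _ _ _ _ x]) (auto simp: x lines_insert sub lines_empty)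
    then show ?thesis by blast
  next
    case 4
    \<comment> \<open>Both O cells leave the lines together, but they share column
      \<open>v\<close>.\<close>
    have "clash (insert x B)" using uv B(4) 4 unfolding clash_def x by (intro bexI[of _ "(a, b)"] bexI[of _ "(u, v)"]) auto
    moreover have L: "lines (R - {a'}) (C - {v}) (insert x B) = {}"
      using 4 B(2) by (auto simp: x lines_insert sub lines_empty)
    moreover have "insert x B \<inter> (R - {a'}) \<times> (C - {v}) \<subseteq> lines (R - {a'}) (C - {v}) (insert x B)"
      by (auto simp: lines_def)
    ultimately have "good R C (insert x B) (a', v)"
      using a' B(3) free[of "(a', v)"] 4 by (auto simp: good_def x)
    then show ?thesis by blast
  next
    case 5
    have "good R C (insert x B) (a', v)"
      using 5 a' B(2-4) free[of "(a', v)"] by (intro good_single[of _ _ _ _ x]) (auto simp: x lines_insert sub lines_empty)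
    then show ?thesis by blast
  next
    case 6
    \<comment> \<open>Here \<open>x\<close> is on no line of the subboard, so column
      \<open>v\<close> is kept in order that \<open>(u, v)\<close> stays.\<close>
    have "good R C (insert x B) (a', b')"
      using 6 a' b' B(2-4) free[of "(a', b')"]
      by (intro good_single[of _ _ _ _ "(u, v)"]) (auto simp: x lines_insert sub lines_empty)
    then show ?thesis by blast
  qed
qed

text \<open>If \<open>x\<close> meets a line of the subboard, X keeps it on exactly one kind of
  line, as the single remaining O cell. Otherwise no O cell shares a line with the answer of
  X.\<close>

lemma good_move_empty:
  assumes card: "card R \<ge> 2" "card C \<ge> 2" and B: "lines R C B = {}"
  shows "\<exists>y. good R C (insert x B) y"
proof -
  obtain a b where x: "x = (a, b)" by (cases x)
  have free: "y \<notin> B" if "y \<in> R \<times> C" for y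
    using that B by (auto simp: lines_def)
  have sub: "lines (R - R') (C - C') B = {}" for R' C'
    using lines_sub[of R R' C C' B] B by (simp add: lines_def)
  obtain a' where a': "a' \<in> R" "a' \<noteq> a" using card_ge_2_other[OF card(1)] .
  obtain b' where b': "b' \<in> C" "b' \<noteq> b" using card_ge_2_other[OF card(2)] .
  consider "a \<in> R" "b \<in> C" | "a \<notin> R" "b \<in> C" | "a \<in> R" "b \<notin> C" | "a \<notin> R" "b \<notin> C" by blast
  then show ?thesis
  proof cases
    case 1
    have "good R C (insert x B) (a, b')"
      using 1 b' free[of "(a, b')"] by (intro good_single[of _ _ _ _ x]) (auto simp: x lines_insert sub)
    then show ?thesis by blast
  next
    case 2
    have "good R C (insert x B) (a', b')"
      using 2 a' b' free[of "(a', b')"] by (intro good_single[of _ _ _ _ x]) (auto simp: x lines_insert sub)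
    then show ?thesis by blast
  next
    case 3
    have "good R C (insert x B) (a', b')"
      using 3 a' b' free[of "(a', b')"] by (intro good_single[of _ _ _ _ x]) (auto simp: x lines_insert sub)
    then show ?thesis by blast
  next
    case 4
    have "lines {a'} {b'} (insert x B) = {}"
      using B a' b' by (auto simp: x lines_def)
    moreover have "insert x B \<inter> (R - {a'}) \<times> (C - {b'}) = {}"
      using 4 free by (auto simp: x)
    ultimately have "good R C (insert x B) (a', b')"
      using a' b' free[of "(a', b')"] 4 by (auto simp: good_def x lines_insert sub)
    then show ?thesis by blast
  qed
qed

text \<open>The single O cell on the lines lies outside the subboard, so it is on a column or on a
  row of it but not both; transposition turns the latter case into the former.\<close>

lemma good_move:
  assumes card: "card R \<ge> 2" "card C \<ge> 2"
    and B: "finite B" "B \<inter> R \<times> C = {}" "card (lines R C B) \<le> 1" "x \<notin> B"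
  shows "\<exists>y. good R C (insert x B) y"
proof -
  have "finite (lines R C B)" using B(1) by (simp add: lines_def)
  then consider "lines R C B = {}" | u v where "lines R C B = {(u, v)}"
    using B(3) by (metis card_0_eq card_1_singletonE le_Suc_eq le_zero_eq One_nat_def surj_pair)
  then show ?thesis
  proof cases
    case 1
    then show ?thesis by (rule good_move_empty[OF card])
  next
    case 2
    then have "(u, v) \<in> lines R C B" by simp
    then have uv: "(u, v) \<in> B" "u \<in> R \<or> v \<in> C" by (simp_all add: lines_def)
    then consider "u \<notin> R" "v \<in> C" | "u \<in> R" "v \<notin> C" using B(2) by blast
    then show ?thesis
    proof cases
      case 1
      then show ?thesis using 2 B by (intro good_move_col[OF card])
    next
      case row: 2
      have "lines C R (prod.swap ` B) = {(v, u)}" unfolding lines_swap 2 by simp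
      moreover have "prod.swap x \<notin> prod.swap ` B" using B(4) by (simp add: swap_image_iff)
      ultimately obtain y where "good C R (insert (prod.swap x) (prod.swap ` B)) y"
        using good_move_col[OF card(2,1)] row by blast
      then have "good C R (prod.swap ` insert x B) y" by simp
      from good_swap[OF this] show ?thesis by blast
    qed
  qed
qed

lemma descent:
  fixes n m :: nat
  assumes "n \<ge> 4" "1 \<le> m" "m < n" "rook n (n - m) A" "B \<subseteq> board n" "A \<inter> B = {}"
    "card B = n - m - 1" "B \<inter> ({..<n} - fst ` A) \<times> ({..<n} - snd ` A) = {}"
    "card (lines ({..<n} - fst ` A) ({..<n} - snd ` A) B) \<le> 1"
    "lines ({..<n} - fst ` A) ({..<n} - snd ` A) B \<noteq> {} \<or> clash B \<or>
      (\<exists>y\<in>A. lines {fst y} {snd y} B = {})"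
  shows "forces n (\<lambda>A B. contains n A) False A B"
  using assms(2-)
proof (induction m arbitrary: A B rule: less_induct)
  case (less m)
  note m = less.prems(1,2) and A = less.prems(3) and B = less.prems(4-6)
  define R C where RC: "R = {..<n} - fst ` A" "C = {..<n} - snd ` A"
  note inv = less.prems(7-9)[folded RC]
  have finB: "finite B" using finite_subset[OF B(1)] by simp
  have sub: "fst ` A \<subseteq> {..<n}" "snd ` A \<subseteq> {..<n}" using A by (auto simp: rook_def board_def)
  have "card (fst ` A) = n - m" "card (snd ` A) = n - m"
    using A by (auto simp: rook_def card_image)
  then have cRC: "card R = m" "card C = m"
    using sub rook_finite[OF A] m by (auto simp: RC card_Diff_subset)
  have RCfree: "y \<in> board n - (A \<union> B)" if "y \<in> R \<times> C" for y
  proof -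
    have "y \<notin> A" using that by (cases y) (force simp: RC)
    moreover have "y \<notin> B" using that inv(1) by blast
    ultimately show ?thesis using that by (auto simp: RC board_def)
  qed
  have ncB: "\<not> contains n B" using finB B(3) m by (intro not_contains) auto
  \<comment> \<open>Even after this move O owns at most \<open>n - m\<close> cells, fewer than a
    transversal.\<close>
  have nc: "\<not> contains n (insert x B)" for x
    using finB B(3) m by (intro not_contains) (auto simp: card_insert_if)
  have "R \<noteq> {}" "C \<noteq> {}" using cRC m by auto
  then obtain r0 c0 where r0: "r0 \<in> R" "c0 \<in> C" by blast
  show ?case
  proof (rule forces_opp[OF ncB RCfree])
    show "(r0, c0) \<in> R \<times> C" using r0 by simp
    fix x
    assume x: "x \<in> board n - (A \<union> B)"
    show "forces n (\<lambda>A B. contains n A) True A (insert x B)"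
    proof (cases "m = 1")
      case True
      with cRC r0 have RC1: "R = {r0}" "C = {c0}" by (auto simp: card_1_singleton_iff)
      have r0': "r0 < n" "r0 \<notin> fst ` A" "c0 < n" "c0 \<notin> snd ` A" using r0 by (auto simp: RC)
      have A': "rook n (n - 1) A" using A True by simp
      show ?thesis
      \<comment> \<open>O must take the last cell of the subboard, or X completes the transversal
        there.\<close>
      proof (cases "x = (r0, c0)")
        case eq: True
        have "(r0, c0) \<notin> B" using inv(1) RC1 by auto
        moreover have "card B = n - 2" using B(3) True by simp
        ultimately show ?thesis
          unfolding eq using B inv(2,3) unfolding RC1 by (intro endgame[OF assms(1) A' r0'])
      next
        case False
        have "rook n (Suc (n - 1)) (insert (r0, c0) A)" by (rule rook_insert[OF A' r0'(1,3,2,4)])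
        then have "rook n n (insert (r0, c0) A)" using m by simp
        then have "contains n (insert (r0, c0) A)" by (rule rook_contains) simp
        then show ?thesis
          using RCfree[of "(r0, c0)"] r0 False by (intro forces_now[OF nc, of "(r0, c0)"]) auto
      qed
    next
      case False
      then have "card R \<ge> 2" "card C \<ge> 2" using m cRC by auto
      then obtain y where y: "good R C (insert x B) y"
        using good_move[OF _ _ finB inv(1,2)] x by blast
      then have yRC: "y \<in> R \<times> C" "y \<notin> insert x B" by (auto simp: good_def)
      obtain r c where rc: "y = (r, c)" by (cases y)
      have r: "r < n" "c < n" "r \<notin> fst ` A" "c \<notin> snd ` A" using yRC by (auto simp: rc RC)
      have RC': "{..<n} - fst ` insert y A = R - {fst y}" "{..<n} - snd ` insert y A = C - {snd y}"
        by (auto simp: RC)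
      have "Suc (n - m) = n - (m - 1)" using m by simp
      with rook_insert[OF A r] have A': "rook n (n - (m - 1)) (insert y A)" by (simp add: rc)
      show ?thesis
      proof (rule forces_own[OF nc])
        show "y \<in> board n - (A \<union> insert x B)" using RCfree[OF yRC(1)] yRC(2) by simp
        show "forces n (\<lambda>A B. contains n A) False (insert y A) (insert x B)"
        proof (rule less.IH[of "m - 1"])
          show "m - 1 < m" "1 \<le> m - 1" "m - 1 < n" using m False by auto
          show "rook n (n - (m - 1)) (insert y A)" by (rule A')
          show "insert x B \<subseteq> board n" using x B(1) by simp
          show "insert y A \<inter> insert x B = {}" using x B(2) yRC(2) by auto
          show "card (insert x B) = n - (m - 1) - 1" using x B(3) finB m False by simp
        \<comment> \<open>In the last alternative of \<open>good\<close>, the witness in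
          \<open>insert y A\<close> is \<open>y\<close> itself.\<close>
        qed (use y in \<open>auto simp only: RC' good_def\<close>)
      qed
    qed
  qed
qed

lemma X_wins_ge_4:
  assumes "n \<ge> 4"
  shows "forces n (\<lambda>A B. contains n A) True {} {}"
proof (rule forces_own)
  show "\<not> contains n {}" using assms by (intro not_contains) auto
  show "(0, 0) \<in> board n - ({} \<union> {})" using assms by (simp add: board_def)
  show "forces n (\<lambda>A B. contains n A) False (insert (0, 0) {}) {}"
    using assms by (intro descent[of n "n - 1"]) (auto simp: lines_def rook_def board_def)
qed

lemma X_wins_1: "forces 1 (\<lambda>A B. contains 1 A) True {} {}"
proof (rule forces_now)
  show "\<not> contains 1 {}" by (intro not_contains) auto
  show "(0, 0) \<in> board 1 - ({} \<union> {})" by (simp add: board_def)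
  have "transversal 1 {(0, 0)}" by (simp add: transversal_def board_def)
  then show "contains 1 (insert (0, 0) {})" unfolding contains_def by blast
qed

theorem theoremA:
  fixes n :: nat
  shows "(n = 1 \<or> n \<ge> 4 \<longrightarrow> has_winning_strategy n PlayerX) \<and>
         (n = 2 \<or> n = 3 \<longrightarrow> game_is_draw n)"
proof (intro conjI impI)
  assume "n = 1 \<or> n \<ge> 4"
  then have "forces n (\<lambda>A B. contains n A) True {} {}"
    using X_wins_1 X_wins_ge_4 by blast
  then show "has_winning_strategy n PlayerX"
    by (intro forces_win) simp
next
  assume "n = 2 \<or> n = 3"
  then show "game_is_draw n"
    using draw_2 draw_3 by blast
qed

end
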